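(* Let $a^-<a^+$ and $b^-<b^+$ be real numbers, and let $A$ be a bounded self-adjoint operator on a Hilbert space $\mathcal{H}$ with $\sigma(A)=\{a^-,a^+\}$. If $B$ is a bounded self-adjoint operator on $\mathcal{H}$ with $\sigma(B)=\{b^-,b^+\}$, then $\sigma(A+iB)\subset\Gamma_{a^-,a^+}^{b^-,b^+}$. Moreover, for any $z\in\Gamma_{a^-,a^+}^{b^-,b^+}$, a bounded self-adjoint operator $B$ with $\sigma(B)=\{b^-,b^+\}$ may be chosen such that $z\in\sigma(A+iB)$.
   Context: For real numbers $\alpha<\beta$ and $\gamma<\delta$ the curve $\Gamma_{\alpha,\beta}^{\gamma,\delta}\subset\mathbb{C}$ is defined as follows. (1) If $\beta-\alpha\le\delta-\gamma$, put for $x\in[\alpha,\beta]$ \[ h_\pm(x)=\frac{\gamma+\delta}{2}\pm\sqrt{\Big(\frac{\delta-\gamma}{2}\Big)^2+(x-\alpha)(x-\beta)}, \] and $\Gamma_{\alpha,\beta}^{\gamma,\delta}=\{x+ih_-(x):x\in[\alpha,\beta]\}\cup\{x+ih_+(x):x\in[\alpha,\beta]\}$. (2) If $\beta-\alpha>\delta-\gamma$, put for $y\in[\gamma,\delta]$ \[ k_\pm(y)=\frac{\alpha+\beta}{2}\pm\sqrt{\Big(\frac{\beta-\alpha}{2}\Big)^2+(y-\gamma)(y-\delta)}, \] and $\Gamma_{\alpha,\beta}^{\gamma,\delta}=\{k_-(y)+iy:y\in[\gamma,\delta]\}\cup\{k_+(y)+iy:y\in[\gamma,\delta]\}$. *)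

theory Defs
  imports "HOL-Analysis.Analysis"
begin

section \<open>Complex Hilbert spaces\<close>

class complex_vector = real_vector +
  fixes scaleC :: "complex \<Rightarrow> 'a \<Rightarrow> 'a" (infixr "*\<^sub>C" 75)
  assumes scaleC_add_right: "c *\<^sub>C (x + y) = c *\<^sub>C x + c *\<^sub>C y"
    and scaleC_add_left: "(c + d) *\<^sub>C x = c *\<^sub>C x + d *\<^sub>C x"
    and scaleC_scaleC: "c *\<^sub>C (d *\<^sub>C x) = (c * d) *\<^sub>C x"
    and scaleC_one: "1 *\<^sub>C x = x"
    and scaleR_scaleC: "r *\<^sub>R x = complex_of_real r *\<^sub>C x"

text \<open>The inner product is linear in the first argument. The norm axioms inherited from
  \<^class>\<open>real_normed_vector\<close> are implied by the inner product axioms; the class is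
  included to fix the distance and the topology induced by the norm.\<close>

class complex_inner = complex_vector + real_normed_vector +
  fixes cinner :: "'a \<Rightarrow> 'a \<Rightarrow> complex"
  assumes cinner_commute: "cinner x y = cnj (cinner y x)"
    and cinner_add_left: "cinner (x + y) z = cinner x z + cinner y z"
    and cinner_scaleC_left: "cinner (c *\<^sub>C x) y = c * cinner x y"
    and cinner_self_nonneg: "0 \<le> Re (cinner x x)"
    and cinner_self_eq_zero_iff: "cinner x x = 0 \<longleftrightarrow> x = 0"
    and norm_eq_sqrt_cinner: "norm x = sqrt (Re (cinner x x))"

class complex_hilbert_space = complex_inner + complete_space

text \<open>The standard spaces \<open>\<complex>\<^sup>n\<close> are instances.\<close>

instantiation complex :: complex_hilbert_space
begin

definition scaleC_complex_def: "c *\<^sub>C (x::complex) = c * x"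
definition cinner_complex_def: "cinner (x::complex) y = x * cnj y"

instance
proof
  fix x :: complex
  show "norm x = sqrt (Re (cinner x x))"
    by (simp add: cinner_complex_def cmod_def power2_eq_square)
qed (auto simp: scaleC_complex_def cinner_complex_def algebra_simps scaleR_conv_of_real)

end

instantiation vec :: (complex_vector, finite) complex_vector
begin

definition scaleC_vec_def: "c *\<^sub>C (x::'a^'b) = (\<chi> i. c *\<^sub>C (x $ i))"

instance
  by standard (simp_all add: scaleC_vec_def vec_eq_iff scaleC_add_right scaleC_add_left
      scaleC_scaleC scaleC_one scaleR_scaleC)

end

instantiation vec :: (complex_inner, finite) complex_inner
begin

definition cinner_vec_def: "cinner (x::'a^'b) y = (\<Sum>i\<in>UNIV. cinner (x $ i) (y $ i))"

instance
proof
  fix x y z :: "'a^'b" and c :: complex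
  have self: "cinner u u = complex_of_real ((norm u)\<^sup>2)" for u :: 'a
  proof (rule complex_eqI)
    show "Re (cinner u u) = Re (complex_of_real ((norm u)\<^sup>2))"
      by (simp add: norm_eq_sqrt_cinner cinner_self_nonneg)
    have "Im (cinner u u) = - Im (cinner u u)"
      using arg_cong[OF cinner_commute[of u u], of Im] by simp
    then show "Im (cinner u u) = Im (complex_of_real ((norm u)\<^sup>2))" by simp
  qed
  have selfv: "cinner x x = complex_of_real (\<Sum>i\<in>UNIV. (norm (x $ i))\<^sup>2)"
    by (simp add: cinner_vec_def self)
  show "cinner x y = cnj (cinner y x)"
    unfolding cinner_vec_def cnj_sum by (intro sum.cong refl cinner_commute)
  show "cinner (x + y) z = cinner x z + cinner y z"
    by (simp add: cinner_vec_def cinner_add_left sum.distrib)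
  show "cinner (c *\<^sub>C x) y = c * cinner x y"
    by (simp add: cinner_vec_def scaleC_vec_def cinner_scaleC_left sum_distrib_left)
  show "0 \<le> Re (cinner x x)"
    unfolding selfv by (simp add: sum_nonneg)
  show "cinner x x = 0 \<longleftrightarrow> x = 0"
    unfolding selfv of_real_eq_0_iff by (simp add: sum_nonneg_eq_0_iff vec_eq_iff)
  show "norm x = sqrt (Re (cinner x x))"
    unfolding selfv by (simp add: norm_vec_def L2_set_def)
qed

end

instance vec :: (complex_hilbert_space, finite) complex_hilbert_space ..


section \<open>Bounded operators\<close>

definition bounded_clinear :: "('a::complex_inner \<Rightarrow> 'a) \<Rightarrow> bool" where
  "bounded_clinear T \<longleftrightarrow> bounded_linear T \<and> (\<forall>c x. T (c *\<^sub>C x) = c *\<^sub>C T x)"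

definition bounded_selfadjoint :: "('a::complex_inner \<Rightarrow> 'a) \<Rightarrow> bool" where
  "bounded_selfadjoint T \<longleftrightarrow> bounded_clinear T \<and> (\<forall>x y. cinner (T x) y = cinner x (T y))"

definition resolvent_set :: "('a::complex_inner \<Rightarrow> 'a) \<Rightarrow> complex set" where
  "resolvent_set T = {z. \<exists>R. bounded_clinear R \<and>
     (\<forall>x. R (T x - z *\<^sub>C x) = x) \<and> (\<forall>x. T (R x) - z *\<^sub>C R x = x)}"

definition spectrum :: "('a::complex_inner \<Rightarrow> 'a) \<Rightarrow> complex set" where
  "spectrum T = - resolvent_set T"


section \<open>The curve\<close>

definition h_minus :: "real \<Rightarrow> real \<Rightarrow> real \<Rightarrow> real \<Rightarrow> real \<Rightarrow> real" where
  "h_minus \<alpha> \<beta> \<gamma> \<delta> x = (\<gamma> + \<delta>) / 2 - sqrt (((\<delta> - \<gamma>) / 2)\<^sup>2 + (x - \<alpha>) * (x - \<beta>))"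

definition h_plus :: "real \<Rightarrow> real \<Rightarrow> real \<Rightarrow> real \<Rightarrow> real \<Rightarrow> real" where
  "h_plus \<alpha> \<beta> \<gamma> \<delta> x = (\<gamma> + \<delta>) / 2 + sqrt (((\<delta> - \<gamma>) / 2)\<^sup>2 + (x - \<alpha>) * (x - \<beta>))"

definition k_minus :: "real \<Rightarrow> real \<Rightarrow> real \<Rightarrow> real \<Rightarrow> real \<Rightarrow> real" where
  "k_minus \<alpha> \<beta> \<gamma> \<delta> y = (\<alpha> + \<beta>) / 2 - sqrt (((\<beta> - \<alpha>) / 2)\<^sup>2 + (y - \<gamma>) * (y - \<delta>))"

definition k_plus :: "real \<Rightarrow> real \<Rightarrow> real \<Rightarrow> real \<Rightarrow> real \<Rightarrow> real" where
  "k_plus \<alpha> \<beta> \<gamma> \<delta> y = (\<alpha> + \<beta>) / 2 + sqrt (((\<beta> - \<alpha>) / 2)\<^sup>2 + (y - \<gamma>) * (y - \<delta>))"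

definition Gamma_curve :: "real \<Rightarrow> real \<Rightarrow> real \<Rightarrow> real \<Rightarrow> complex set" where
  "Gamma_curve \<alpha> \<beta> \<gamma> \<delta> =
     (if \<beta> - \<alpha> \<le> \<delta> - \<gamma>
      then (\<lambda>x. Complex x (h_minus \<alpha> \<beta> \<gamma> \<delta> x)) ` {\<alpha>..\<beta>} \<union>
           (\<lambda>x. Complex x (h_plus \<alpha> \<beta> \<gamma> \<delta> x)) ` {\<alpha>..\<beta>}
      else (\<lambda>y. Complex (k_minus \<alpha> \<beta> \<gamma> \<delta> y) y) ` {\<gamma>..\<delta>} \<union>
           (\<lambda>y. Complex (k_plus \<alpha> \<beta> \<gamma> \<delta> y) y) ` {\<gamma>..\<delta>})"

end

theory Submission
  imports Defs
begin

text \<open>Subtracting the midpoints of the spectra turns \<open>A\<close>, \<open>B\<close> into \<open>D\<close>, \<open>E\<close> with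
  \<open>D\<^sup>2 = r\<^sup>2\<close>, \<open>E\<^sup>2 = s\<^sup>2\<close>, where \<open>r\<close>, \<open>s\<close> are half the gaps, since a self-adjoint operator with
  spectrum \<open>{0}\<close> vanishes. In the centred variable \<open>w = x + i y\<close> both cases of the curve become
  \<open>x\<^sup>2 - y\<^sup>2 = r\<^sup>2 - s\<^sup>2\<close>, \<open>\<bar>x y\<bar> \<le> r s\<close>, that is \<open>w\<^sup>2 \<in> r\<^sup>2 - s\<^sup>2 + i [-2 r s, 2 r s]\<close>. The square
  of \<open>D + i E\<close> has its spectrum in this segment, and a reflection \<open>E\<close> in a vector of the plane
  spanned by two eigenvectors of \<open>D\<close> realises any given point.\<close>

text \<open>Imports the laws for differences and negatives of scalars and vectors, which the class
  axioms do not list.\<close>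

interpretation cvec: module "scaleC :: complex \<Rightarrow> 'a::complex_vector \<Rightarrow> 'a"
  by standard (simp_all add: scaleC_add_right scaleC_add_left scaleC_scaleC scaleC_one)

lemmas cvec_simps = scaleC_add_right scaleC_add_left scaleC_scaleC scaleC_one
  cvec.scale_right_diff_distrib cvec.scale_left_diff_distrib

section \<open>Inner products\<close>

lemma cinner_add_right: "cinner (x::'a::complex_inner) (y + z) = cinner x y + cinner x z"
  by (metis cinner_add_left cinner_commute complex_cnj_add)

lemma cinner_scaleC_right: "cinner (x::'a::complex_inner) (c *\<^sub>C y) = cnj c * cinner x y"
  by (metis cinner_scaleC_left cinner_commute complex_cnj_mult)

lemma cinner_zero [simp]:
  "cinner 0 (x::'a::complex_inner) = 0" "cinner (x::'a::complex_inner) 0 = 0"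
  using cinner_scaleC_left[of 0 0 x] cinner_scaleC_right[of x 0 0] by simp_all

lemma cinner_minus [simp]:
  "cinner (- x) (y::'a::complex_inner) = - cinner x y"
  "cinner x (- y) = - cinner x (y::'a::complex_inner)"
  using cinner_scaleC_left[of "-1" x y] cinner_scaleC_right[of x "-1" y]
  by (simp_all add: scaleC_one)

lemma cinner_diff:
  "cinner (x - y) (z::'a::complex_inner) = cinner x z - cinner y z"
  "cinner z (x - y) = cinner z x - cinner z (y::'a::complex_inner)"
  using cinner_add_left[of x "- y" z] cinner_add_right[of z x "- y"] by simp_all

lemmas cinner_simps = cinner_add_left cinner_add_right cinner_scaleC_left cinner_scaleC_right
  cinner_diff

lemma cinner_self: "cinner x x = complex_of_real ((norm (x::'a::complex_inner))\<^sup>2)"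
proof (rule complex_eqI)
  show "Re (cinner x x) = Re (complex_of_real ((norm x)\<^sup>2))"
    by (simp add: norm_eq_sqrt_cinner cinner_self_nonneg)
  show "Im (cinner x x) = Im (complex_of_real ((norm x)\<^sup>2))"
    using arg_cong[OF cinner_commute[of x x], of Im] by simp
qed

lemma norm_scaleC [simp]: "norm (c *\<^sub>C (x::'a::complex_inner)) = cmod c * norm x"
proof -
  have "cinner (c *\<^sub>C x) (c *\<^sub>C x) = c * cnj c * cinner x x"
    by (simp add: cinner_simps)
  also have "\<dots> = complex_of_real ((cmod c * norm x)\<^sup>2)"
    by (simp only: cinner_self complex_norm_square[symmetric] power_mult_distrib of_real_mult)
  finally have "(norm (c *\<^sub>C x))\<^sup>2 = (cmod c * norm x)\<^sup>2"
    unfolding cinner_self of_real_eq_iff .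
  then show ?thesis by simp
qed

lemma norm_add_square:
  "(norm (x + y))\<^sup>2 = (norm x)\<^sup>2 + (norm y)\<^sup>2 + 2 * Re (cinner x (y::'a::complex_inner))"
proof -
  have "complex_of_real ((norm (x + y))\<^sup>2) =
      complex_of_real ((norm x)\<^sup>2) + complex_of_real ((norm y)\<^sup>2) + (cinner x y + cnj (cinner x y))"
    unfolding cinner_self[symmetric] cinner_commute[of y x, symmetric] by (simp add: cinner_simps)
  from arg_cong[OF this, of Re] show ?thesis by simp
qed

lemma norm_diff_square:
  "(norm (x - y))\<^sup>2 = (norm x)\<^sup>2 + (norm y)\<^sup>2 - 2 * Re (cinner x (y::'a::complex_inner))"
  using norm_add_square[of x "- y"] by simp

text \<open>Scaling \<open>x\<close> by \<open>norm y\<close> and \<open>y\<close> by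
  \<open>norm x\<close> gives two vectors of equal norm; expanding the squared norm of their
  difference, which is nonnegative, yields the bound.\<close>

lemma Re_cinner_le: "Re (cinner x (y::'a::complex_inner)) \<le> norm x * norm y"
proof (cases "x = 0 \<or> y = 0")
  case False
  define s t where "s = norm y" and "t = norm x"
  have pos: "s * t > 0" using False by (simp add: s_def t_def)
  have "0 \<le> (norm (complex_of_real s *\<^sub>C x - complex_of_real t *\<^sub>C y))\<^sup>2" by simp
  also have "\<dots> = 2 * (s * t) * (s * t) - 2 * (s * t) * Re (cinner x y)"
    by (simp add: norm_diff_square cinner_simps power_mult_distrib)
       (simp add: s_def t_def power2_eq_square algebra_simps)
  finally have "(s * t) * Re (cinner x y) \<le> (s * t) * (s * t)" by simp
  then have "Re (cinner x y) \<le> s * t" using pos by (simp only: mult_le_cancel_left_pos)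
  then show ?thesis by (simp add: s_def t_def mult.commute)
qed auto

text \<open>Multiplying \<open>x\<close> by a unit complex number makes the inner product real and
  nonnegative, which reduces the claim to \<open>Re_cinner_le\<close>.\<close>

lemma norm_cinner_le: "cmod (cinner x (y::'a::complex_inner)) \<le> norm x * norm y"
proof (cases "cinner x y = 0")
  case False
  define c where "c = cnj (sgn (cinner x y))"
  have c: "cmod c = 1" using False by (simp add: c_def norm_sgn)
  have "complex_of_real (cmod (cinner x y)) = cnj (cinner x y) * cinner x y / cmod (cinner x y)"
    using complex_norm_square[of "cinner x y"] False by (simp add: field_simps power2_eq_square)
  also have "\<dots> = cinner (c *\<^sub>C x) y"
    by (simp add: c_def sgn_div_norm cinner_simps scaleR_conv_of_real field_simps)
  finally have "cmod (cinner x y) = Re (cinner (c *\<^sub>C x) y)"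
    by (metis Re_complex_of_real)
  also have "\<dots> \<le> norm (c *\<^sub>C x) * norm y" by (rule Re_cinner_le)
  finally show ?thesis by (simp add: c)
qed simp

section \<open>Bounded operators\<close>

lemma bounded_clinearI:
  fixes T :: "'a::complex_inner \<Rightarrow> 'a"
  assumes "\<And>x y. T (x + y) = T x + T y" "\<And>c x. T (c *\<^sub>C x) = c *\<^sub>C T x"
    and "\<And>x. norm (T x) \<le> norm x * K"
  shows "bounded_clinear T"
  unfolding bounded_clinear_def
  using assms by (auto intro!: bounded_linear_intro simp: scaleR_scaleC)

lemma bounded_clinear_bounded_linear: "bounded_clinear T \<Longrightarrow> bounded_linear T"
  by (simp add: bounded_clinear_def)

lemma bounded_clinear_simps:
  assumes "bounded_clinear T"
  shows "T (x + y) = T x + T y" "T (x - y) = T x - T y" "T 0 = 0" "T (- x) = - T x"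
    "T (c *\<^sub>C x) = c *\<^sub>C T x"
proof -
  interpret bounded_linear T using assms by (rule bounded_clinear_bounded_linear)
  show "T (x + y) = T x + T y" "T (x - y) = T x - T y" "T 0 = 0" "T (- x) = - T x"
    by (rule add diff zero neg)+
  show "T (c *\<^sub>C x) = c *\<^sub>C T x" using assms by (simp add: bounded_clinear_def)
qed

lemma bounded_clinear_scaleC:
  "bounded_clinear (T::'a::complex_inner \<Rightarrow> 'a) \<Longrightarrow> bounded_clinear (\<lambda>x. c *\<^sub>C T x)"
proof -
  assume T: "bounded_clinear T"
  obtain K where "\<And>x. norm (T x) \<le> norm x * K"
    using bounded_linear.bounded[OF bounded_clinear_bounded_linear[OF T]] by blast
  then have "norm (c *\<^sub>C T x) \<le> norm x * (K * cmod c)" for x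
    by (simp add: mult.assoc[symmetric] mult.commute[of "cmod c"] mult_right_mono)
  then show ?thesis
    by (rule bounded_clinearI[rotated 2])
      (simp_all add: bounded_clinear_simps[OF T] cvec_simps mult.commute)
qed

lemma bounded_clinear_id: "bounded_clinear (\<lambda>x::'a::complex_inner. x)"
  by (simp add: bounded_clinear_def)

lemma bounded_clinear_add:
  "bounded_clinear S \<Longrightarrow> bounded_clinear T \<Longrightarrow> bounded_clinear (\<lambda>x. S x + T x)"
  by (simp add: bounded_clinear_def bounded_linear_add cvec_simps)

lemma bounded_clinear_diff:
  "bounded_clinear S \<Longrightarrow> bounded_clinear T \<Longrightarrow> bounded_clinear (\<lambda>x. S x - T x)"
  by (simp add: bounded_clinear_def bounded_linear_sub cvec_simps)

lemma bounded_clinear_compose: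
  "bounded_clinear S \<Longrightarrow> bounded_clinear T \<Longrightarrow> bounded_clinear (\<lambda>x. S (T x))"
  by (simp add: bounded_clinear_def bounded_linear_compose)

lemma bounded_selfadjoint_bounded_clinear: "bounded_selfadjoint T \<Longrightarrow> bounded_clinear T"
  by (simp add: bounded_selfadjoint_def)

lemma bounded_selfadjoint_shift:
  "bounded_selfadjoint T \<Longrightarrow> bounded_selfadjoint (\<lambda>x. T x - complex_of_real m *\<^sub>C x)"
  unfolding bounded_selfadjoint_def
  by (auto simp: cinner_simps intro!: bounded_clinear_diff bounded_clinear_scaleC bounded_clinear_id)

section \<open>Invertibility and the spectrum\<close>

text \<open>Stated for an arbitrary operator rather than for \<open>T - z\<close>, so that products
  and factors of such operators can be treated.\<close>

definition cinvertible :: "('a::complex_inner \<Rightarrow> 'a) \<Rightarrow> bool" where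
  "cinvertible T \<longleftrightarrow> (\<exists>R. bounded_clinear R \<and> (\<forall>x. R (T x) = x) \<and> (\<forall>x. T (R x) = x))"

lemma spectrum_iff: "z \<in> spectrum T \<longleftrightarrow> \<not> cinvertible (\<lambda>x. T x - z *\<^sub>C x)"
  by (simp add: spectrum_def resolvent_set_def cinvertible_def)

lemma spectrum_shift: "z \<in> spectrum (\<lambda>x. T x - c *\<^sub>C x) \<longleftrightarrow> z + c \<in> spectrum T"
  by (simp add: spectrum_iff cvec_simps algebra_simps)

lemma eigenvalue_in_spectrum:
  assumes "T x = z *\<^sub>C x" "x \<noteq> 0"
  shows "z \<in> spectrum T"
  using assms bounded_clinear_simps(3) unfolding spectrum_iff cinvertible_def
  by (metis diff_self)

lemma cinvertible_scale:
  assumes "c \<noteq> 0"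
  shows "cinvertible (\<lambda>x. c *\<^sub>C (x::'a::complex_inner))"
  unfolding cinvertible_def using assms
  by (intro exI[of _ "\<lambda>x. inverse c *\<^sub>C x"])
    (auto simp: scaleC_scaleC scaleC_one bounded_clinear_scaleC bounded_clinear_id)

lemma cinvertible_compose:
  "cinvertible S \<Longrightarrow> cinvertible T \<Longrightarrow> cinvertible (\<lambda>x. S (T x))"
  unfolding cinvertible_def by (metis bounded_clinear_compose)

text \<open>If \<open>R\<close> inverts \<open>S T\<close>, then \<open>T R\<close> is a right
  inverse of \<open>S\<close>. Since \<open>T\<close> commutes with \<open>S T\<close>, it commutes
  with \<open>R\<close>, so \<open>T R\<close> is a left inverse too.\<close>

lemma cinvertible_factor:
  assumes "bounded_clinear T" and comm: "\<And>x. S (T x) = T (S x)"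
    and "cinvertible (\<lambda>x. S (T x))"
  shows "cinvertible S"
proof -
  obtain R where R: "bounded_clinear R" "\<And>x. R (S (T x)) = x" "\<And>x. S (T (R x)) = x"
    using assms(3) by (auto simp: cinvertible_def)
  have "T (R (S x)) = x" for x
  proof -
    have RT: "R (T y) = T (R y)" for y by (metis R(2,3) comm)
    show ?thesis by (metis RT R(2) comm)
  qed
  then show ?thesis
    using bounded_clinear_compose[OF assms(1) R(1)] R(3) by (auto simp: cinvertible_def)
qed

text \<open>The factors of \<open>T^2 - z^2 = (T - z)(T + z)\<close> commute. Contraposed, a
  spectral value of \<open>T\<close> has its square in the spectrum of \<open>T^2\<close>.\<close>

lemma cinvertible_square_factor:
  assumes T: "bounded_clinear T" and "cinvertible (\<lambda>x. T (T x) - z\<^sup>2 *\<^sub>C x)"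
  shows "cinvertible (\<lambda>x. T x - z *\<^sub>C x)"
proof (rule cinvertible_factor)
  note lin = bounded_clinear_simps[OF T]
  show "bounded_clinear (\<lambda>x. T x + z *\<^sub>C x)"
    by (intro bounded_clinear_add bounded_clinear_scaleC bounded_clinear_id T)
  show "T (T x + z *\<^sub>C x) - z *\<^sub>C (T x + z *\<^sub>C x) =
      T (T x - z *\<^sub>C x) + z *\<^sub>C (T x - z *\<^sub>C x)" for x
    by (simp add: lin cvec_simps)
  show "cinvertible (\<lambda>x. T (T x + z *\<^sub>C x) - z *\<^sub>C (T x + z *\<^sub>C x))"
    using assms(2) by (simp add: lin cvec_simps power2_eq_square)
qed

text \<open>For small \<open>t\<close> the map \<open>x \<mapsto> x - t (P x - y)\<close> is a contraction whose fixed point solves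
  \<open>P x = y\<close>.\<close>

lemma coercive_cinvertible:
  fixes P :: "'a::complex_hilbert_space \<Rightarrow> 'a"
  assumes P: "bounded_clinear P" and m: "m > 0"
    and coercive: "\<And>x. m * (norm x)\<^sup>2 \<le> Re (cinner (P x) x)"
  shows "cinvertible P"
proof -
  note lin = bounded_clinear_simps[OF P]
  obtain K0 where K0: "0 < K0" "\<And>x. norm (P x) \<le> norm x * K0"
    using bounded_linear.pos_bounded[OF bounded_clinear_bounded_linear[OF P]] by blast
  \<comment> \<open>Enlarging the bound by \<open>m\<close> ensures \<open>m < K\<close>, so that
    the constant \<open>q\<close> below is nonnegative.\<close>
  define K where "K = K0 + m"
  have K: "0 < K" "m < K" using K0 m by (auto simp: K_def)
  have bound: "norm (P x) \<le> K * norm x" for x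
    using K0(2)[of x] m by (simp add: K_def algebra_simps add_increasing2)
  \<comment> \<open>This \<open>t\<close> minimises \<open>1 - 2 t m + t^2 K^2\<close>, the bound
    for the squared contraction factor; the minimum is \<open>q\<close>.\<close>
  define t where "t = m / K\<^sup>2"
  define q where "q = 1 - m\<^sup>2 / K\<^sup>2"
  have q: "0 \<le> q" "q < 1"
    using K m by (auto simp: q_def field_simps power_mono)
  have contraction: "norm (d - complex_of_real t *\<^sub>C P d) \<le> sqrt q * norm d" for d
  proof -
    have "(norm (d - complex_of_real t *\<^sub>C P d))\<^sup>2 =
        (norm d)\<^sup>2 + t\<^sup>2 * (norm (P d))\<^sup>2 - 2 * t * Re (cinner (P d) d)"
      using arg_cong[OF cinner_commute[of d "P d"], of Re]
      by (simp add: norm_diff_square cinner_simps power_mult_distrib)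
    also have "\<dots> \<le> (norm d)\<^sup>2 + t\<^sup>2 * (K * norm d)\<^sup>2 - 2 * t * (m * (norm d)\<^sup>2)"
      using m K by (intro diff_mono add_mono mult_left_mono power_mono bound coercive)
        (auto simp: t_def)
    also have "\<dots> = q * (norm d)\<^sup>2"
      using K by (simp add: t_def q_def power2_eq_square field_simps)
    also have "\<dots> = (sqrt q * norm d)\<^sup>2" using q by (simp add: power_mult_distrib)
    finally show ?thesis using q by (simp add: power2_le_iff_abs_le)
  qed
  have surj: "\<exists>x. P x = y" for y
  proof -
    define f where "f x = x - complex_of_real t *\<^sub>C (P x - y)" for x
    have "\<exists>!x. f x = x"
    proof (rule banach_fix_type[of "sqrt q"])
      show "\<forall>x z. dist (f x) (f z) \<le> sqrt q * dist x z"
      proof (intro allI)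
        fix x z
        have "f x - f z = (x - z) - complex_of_real t *\<^sub>C P (x - z)"
          by (simp add: f_def lin cvec_simps)
        then show "dist (f x) (f z) \<le> sqrt q * dist x z"
          using contraction[of "x - z"] by (simp add: dist_norm)
      qed
    qed (use q in auto)
    then obtain x where "f x = x" by blast
    then have "norm (complex_of_real t *\<^sub>C (P x - y)) = 0" by (simp add: f_def)
    then show ?thesis using m K by (auto simp: t_def)
  qed
  \<comment> \<open>Coercivity and Cauchy-Schwarz bound \<open>P\<close> from below, which gives
    both injectivity and the bound \<open>1 / m\<close> for the inverse.\<close>
  have lower: "m * norm x \<le> norm (P x)" for x
  proof (cases "x = 0")
    case False
    have "m * norm x * norm x \<le> norm (P x) * norm x"
      using coercive[of x] Re_cinner_le[of "P x" x] by (simp add: power2_eq_square mult.assoc)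
    then show ?thesis using False by simp
  qed (simp add: lin)
  have inj: "x = y" if "P x = P y" for x y
    using lower[of "x - y"] that m by (simp add: lin mult_le_0_iff)
  define R where "R = inv P"
  have PR: "P (R y) = y" for y unfolding R_def using surj by (metis surjI surj_def surj_f_inv_f)
  have RP: "R (P x) = x" for x by (rule inj) (rule PR)
  have "bounded_clinear R"
  proof (rule bounded_clinearI)
    show "R (x + y) = R x + R y" for x y by (rule inj) (simp add: lin PR)
    show "R (c *\<^sub>C x) = c *\<^sub>C R x" for c x by (rule inj) (simp add: lin PR)
    show "norm (R y) \<le> norm y * (1 / m)" for y
      using lower[of "R y"] m by (simp add: PR field_simps)
  qed
  with PR RP show ?thesis by (auto simp: cinvertible_def)
qed

text \<open>A numerical range in some open half plane whose boundary has positive distance from 0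
  suffices for invertibility: \<open>c\<close> turns it into the right half plane.\<close>

lemma rotated_coercive_cinvertible:
  fixes P :: "'a::complex_hilbert_space \<Rightarrow> 'a"
  assumes P: "bounded_clinear P" and "c \<noteq> 0" "m > 0"
    and "\<And>x. m * (norm x)\<^sup>2 \<le> Re (c * cinner (P x) x)"
  shows "cinvertible P"
proof (rule cinvertible_factor)
  have "cinvertible (\<lambda>x. c *\<^sub>C P x)"
    using assms
    by (intro coercive_cinvertible[of _ m]) (auto simp: cinner_simps bounded_clinear_scaleC)
  then show "cinvertible (\<lambda>x. P (c *\<^sub>C x))" by (simp add: bounded_clinear_simps[OF P])
qed (simp_all add: bounded_clinear_simps[OF P] bounded_clinear_scaleC bounded_clinear_id)

section \<open>Self-adjoint operators with two-point spectrum\<close>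

text \<open>With \<open>M = onorm T\<close>, self-adjointness bounds the squared norm of
  \<open>(T^2 - M^2) x\<close> by \<open>M^2 (M^2 |x|^2 - |T x|^2)\<close>, which is small when
  \<open>x\<close> nearly attains the norm. A bounded inverse would therefore improve the bound
  \<open>M\<close> strictly.\<close>

lemma selfadjoint_norm_not_cinvertible:
  fixes T :: "'a::complex_inner \<Rightarrow> 'a"
  assumes T: "bounded_selfadjoint T" and M: "onorm T \<noteq> 0"
  shows "\<not> cinvertible (\<lambda>x. T (T x) - complex_of_real ((onorm T)\<^sup>2) *\<^sub>C x)"
proof
  define M where "M = onorm T"
  have bl: "bounded_linear T"
    using T by (simp add: bounded_selfadjoint_def bounded_clinear_def)
  have Mpos: "M > 0" using M onorm_pos_le[OF bl] by (simp add: M_def)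
  have le: "norm (T x) \<le> M * norm x" for x unfolding M_def by (rule onorm[OF bl])
  assume "cinvertible (\<lambda>x. T (T x) - complex_of_real ((onorm T)\<^sup>2) *\<^sub>C x)"
  then obtain R where R: "bounded_clinear R"
    "\<And>x. R (T (T x) - complex_of_real (M\<^sup>2) *\<^sub>C x) = x"
    by (auto simp: cinvertible_def M_def)
  obtain K where K: "0 < K" "\<And>x. norm (R x) \<le> norm x * K"
    using bounded_linear.pos_bounded[OF bounded_clinear_bounded_linear[OF R(1)]] by blast
  \<comment> \<open>The second argument of \<open>max\<close> results from solving
    \<open>|x|^2 <= K^2 M^2 (M^2 |x|^2 - |T x|^2)\<close> for \<open>|T x|^2\<close>; the
    \<open>max\<close> keeps the radicand nonnegative.\<close>
  define L where "L = sqrt (max 0 (M\<^sup>2 - 1 / (K\<^sup>2 * M\<^sup>2)))"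
  have "norm (T x) \<le> L * norm x" for x
  proof -
    have "(norm x)\<^sup>2 \<le> (norm (T (T x) - complex_of_real (M\<^sup>2) *\<^sub>C x) * K)\<^sup>2"
      using K(2)[of "T (T x) - complex_of_real (M\<^sup>2) *\<^sub>C x"] unfolding R(2)
      by (intro power_mono) auto
    also have "\<dots> = K\<^sup>2 * ((norm (T (T x)))\<^sup>2 + (M\<^sup>2 * norm x)\<^sup>2 - 2 * M\<^sup>2 * (norm (T x))\<^sup>2)"
    proof -
      have "cinner (T (T x)) x = cinner (T x) (T x)"
        using T by (simp add: bounded_selfadjoint_def)
      then show ?thesis
        by (simp add: norm_diff_square cinner_simps power_mult_distrib cinner_self norm_power)
    qed
    also have "\<dots> \<le> K\<^sup>2 * ((M * norm (T x))\<^sup>2 + (M\<^sup>2 * norm x)\<^sup>2 - 2 * M\<^sup>2 * (norm (T x))\<^sup>2)"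
      by (intro mult_left_mono diff_mono add_mono power_mono le) auto
    also have "\<dots> = K\<^sup>2 * M\<^sup>2 * (M\<^sup>2 * (norm x)\<^sup>2 - (norm (T x))\<^sup>2)"
      by (simp add: power2_eq_square algebra_simps)
    finally have "(norm (T x))\<^sup>2 \<le> (M\<^sup>2 - 1 / (K\<^sup>2 * M\<^sup>2)) * (norm x)\<^sup>2"
      using K Mpos by (simp add: field_simps)
    also have "\<dots> \<le> L\<^sup>2 * (norm x)\<^sup>2" by (simp add: L_def mult_right_mono)
    finally have "(norm (T x))\<^sup>2 \<le> (L * norm x)\<^sup>2" by (simp add: power_mult_distrib)
    then show ?thesis by (rule power2_le_imp_le) (simp add: L_def)
  qed
  then have "M \<le> L" unfolding M_def by (intro onorm_bound) (simp_all add: L_def)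
  then have "M\<^sup>2 \<le> L\<^sup>2" using Mpos by (intro power_mono) auto
  moreover have "L\<^sup>2 = max 0 (M\<^sup>2 - 1 / (K\<^sup>2 * M\<^sup>2))" by (simp add: L_def)
  moreover have "0 < M\<^sup>2" "0 < 1 / (K\<^sup>2 * M\<^sup>2)" using Mpos K by simp_all
  ultimately show False by linarith
qed

text \<open>For \<open>c\<close> nonzero, \<open>D^2 - r^2 - c\<close> factors as
  \<open>(D - s)(D + s)\<close> with \<open>s^2 = r^2 + c\<close>, so neither \<open>s\<close> nor
  \<open>-s\<close> is in the spectrum of \<open>D\<close>. Hence \<open>T = D^2 - r^2\<close> has
  no nonzero spectral value, and by the previous lemma its norm is 0.\<close>

lemma selfadjoint_square_eq:
  fixes D :: "'a::complex_inner \<Rightarrow> 'a"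
  assumes D: "bounded_selfadjoint D" and sp: "spectrum D \<subseteq> {complex_of_real r, - complex_of_real r}"
  shows "D (D x) = complex_of_real (r\<^sup>2) *\<^sub>C x"
proof -
  have bD: "bounded_clinear D" using D by (rule bounded_selfadjoint_bounded_clinear)
  note lin = bounded_clinear_simps[OF bD]
  define T where "T x = D (D x) - complex_of_real (r\<^sup>2) *\<^sub>C x" for x
  have bT: "bounded_clinear T"
    unfolding T_def by (intro bounded_clinear_diff bounded_clinear_compose[OF bD bD]
        bounded_clinear_scaleC bounded_clinear_id)
  note linT = bounded_clinear_simps[OF bT]
  have T: "bounded_selfadjoint T"
    using bT D by (simp add: bounded_selfadjoint_def T_def cinner_simps)
  have inv: "cinvertible (\<lambda>x. T x - c *\<^sub>C x)" if "c \<noteq> 0" for c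
  proof -
    define s where "s = csqrt (complex_of_real (r\<^sup>2) + c)"
    have s2: "s * s = complex_of_real (r\<^sup>2) + c"
      unfolding power2_eq_square[symmetric] s_def by simp
    then have "s \<noteq> complex_of_real r" "s \<noteq> - complex_of_real r"
      using that by (auto simp: power2_eq_square)
    then have "s \<notin> {complex_of_real r, - complex_of_real r}"
      "- s \<notin> {complex_of_real r, - complex_of_real r}"
      by (metis insertE singletonD minus_minus)+
    then have "s \<notin> spectrum D" "- s \<notin> spectrum D"
      using sp by blast+
    then have "cinvertible (\<lambda>x. D x - s *\<^sub>C x)" "cinvertible (\<lambda>x. D x - (-s) *\<^sub>C x)"
      unfolding spectrum_iff by blast+
    from cinvertible_compose[OF this] show ?thesis
      by (simp add: T_def lin cvec_simps s2 diff_diff_eq)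
  qed
  have "onorm T = 0"
  proof (rule ccontr)
    assume M: "onorm T \<noteq> 0"
    have "cinvertible (\<lambda>x. T x - complex_of_real (onorm T) *\<^sub>C x)"
      "cinvertible (\<lambda>x. T x - (- complex_of_real (onorm T)) *\<^sub>C x)"
      using M by (intro inv; simp)+
    from cinvertible_compose[OF this] have
      "cinvertible (\<lambda>x. T (T x) - complex_of_real ((onorm T)\<^sup>2) *\<^sub>C x)"
      by (simp add: linT cvec_simps power2_eq_square)
    with selfadjoint_norm_not_cinvertible[OF T M] show False ..
  qed
  then have "T x = 0"
    using bT by (simp add: onorm_eq_0 bounded_clinear_bounded_linear)
  then show ?thesis by (simp add: T_def)
qed

text \<open>Here \<open>D^2 - z^2\<close> is the scalar \<open>c^2 - z^2\<close>, invertible unless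
  \<open>z\<close> is \<open>c\<close> or \<open>-c\<close>.\<close>

lemma spectrum_square_subset:
  fixes D :: "'a::complex_inner \<Rightarrow> 'a"
  assumes D: "bounded_clinear D" and sq: "\<And>x. D (D x) = c\<^sup>2 *\<^sub>C x"
  shows "spectrum D \<subseteq> {c, - c}"
proof
  fix z assume z: "z \<in> spectrum D"
  show "z \<in> {c, - c}"
  proof (rule ccontr)
    assume "z \<notin> {c, - c}"
    then have "c\<^sup>2 - z\<^sup>2 \<noteq> 0" by (auto simp: power2_eq_iff)
    then have "cinvertible (\<lambda>x::'a. (c\<^sup>2 - z\<^sup>2) *\<^sub>C x)" by (rule cinvertible_scale)
    then have "cinvertible (\<lambda>x. D x - z *\<^sub>C x)"
      unfolding cvec.scale_left_diff_distrib sq[symmetric]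
      by (rule cinvertible_square_factor[OF D])
    with z show False by (simp add: spectrum_iff)
  qed
qed

text \<open>Since \<open>(D - c)(D + c) = 0\<close>, every nonzero vector in the range of
  \<open>D + c\<close> is an eigenvector for \<open>c\<close>. Were that range zero,
  \<open>D - c\<close> would be the invertible scalar \<open>-2 c\<close>.\<close>

lemma square_eigenvector:
  fixes D :: "'a::complex_inner \<Rightarrow> 'a"
  assumes D: "bounded_clinear D" and sq: "\<And>x. D (D x) = c\<^sup>2 *\<^sub>C x"
    and "c \<in> spectrum D" "c \<noteq> 0"
  shows "\<exists>u. norm u = 1 \<and> D u = c *\<^sub>C u"
proof -
  note lin = bounded_clinear_simps[OF D]
  have "\<exists>x. D x + c *\<^sub>C x \<noteq> 0"
  proof (rule ccontr)
    assume "\<nexists>x. D x + c *\<^sub>C x \<noteq> 0"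
    then have "D x - c *\<^sub>C x = (- 2 * c) *\<^sub>C x" for x
      using add_eq_0_iff2[of "D x" "c *\<^sub>C x"]
      by (metis (no_types, lifting) cvec.scale_left_diff_distrib cvec.scale_minus_left
          diff_minus_eq_add minus_diff_eq mult_2 mult_minus_left uminus_add_conv_diff)
    moreover have "cinvertible (\<lambda>x::'a. (- 2 * c) *\<^sub>C x)"
      using assms(4) by (intro cinvertible_scale) simp
    ultimately show False using assms(3) by (simp add: spectrum_iff)
  qed
  then obtain x where x: "D x + c *\<^sub>C x \<noteq> 0" by blast
  define y where "y = D x + c *\<^sub>C x"
  have y: "D y = c *\<^sub>C y"
    by (simp add: y_def lin cvec_simps sq power2_eq_square)
  show ?thesis
    using x y by (intro exI[of _ "complex_of_real (1 / norm y) *\<^sub>C y"])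
      (auto simp: y_def[symmetric] lin scaleC_scaleC mult.commute norm_divide)
qed

section \<open>The curve\<close>

text \<open>Merges the two cases of the curve into one condition, symmetric in the two axes, on the
  square of the centred variable. On the hyperbola, the bounds \<open>|x| <= r\<close>,
  \<open>|y| <= s\<close> and \<open>|x y| <= r s\<close> are equivalent.\<close>

lemma Gamma_curve_iff:
  assumes "\<alpha> < \<beta>" "\<gamma> < \<delta>"
  defines "r \<equiv> (\<beta> - \<alpha>) / 2" and "s \<equiv> (\<delta> - \<gamma>) / 2"
  shows "z \<in> Gamma_curve \<alpha> \<beta> \<gamma> \<delta> \<longleftrightarrow>
    (Re z - (\<alpha> + \<beta>) / 2)\<^sup>2 - (Im z - (\<gamma> + \<delta>) / 2)\<^sup>2 = r\<^sup>2 - s\<^sup>2 \<and>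
    \<bar>(Re z - (\<alpha> + \<beta>) / 2) * (Im z - (\<gamma> + \<delta>) / 2)\<bar> \<le> r * s"
proof -
  define x y where "x = Re z - (\<alpha> + \<beta>) / 2" and "y = Im z - (\<gamma> + \<delta>) / 2"
  have r: "r > 0" and s: "s > 0" using assms by auto
  have box: "x\<^sup>2 - y\<^sup>2 = r\<^sup>2 - s\<^sup>2 \<and> \<bar>x * y\<bar> \<le> r * s \<longleftrightarrow> x\<^sup>2 - y\<^sup>2 = r\<^sup>2 - s\<^sup>2 \<and> \<bar>x\<bar> \<le> r"
  proof (intro conj_cong refl iffI)
    assume hyp: "x\<^sup>2 - y\<^sup>2 = r\<^sup>2 - s\<^sup>2"
    {
      assume "\<bar>x * y\<bar> \<le> r * s"
      then have "(x * y)\<^sup>2 \<le> (r * s)\<^sup>2" by (metis abs_ge_zero power2_abs power_mono)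
      \<comment> \<open>On the hyperbola the difference factors, and the second factor is positive,
        so the sign is that of \<open>x^2 - r^2\<close>.\<close>
      moreover have "(x * y)\<^sup>2 - (r * s)\<^sup>2 = (x\<^sup>2 - r\<^sup>2) * (x\<^sup>2 + s\<^sup>2)"
      proof -
        have y2: "y\<^sup>2 = x\<^sup>2 - r\<^sup>2 + s\<^sup>2" using hyp by simp
        show ?thesis unfolding power_mult_distrib y2 by (simp add: algebra_simps)
      qed
      ultimately have "(x\<^sup>2 - r\<^sup>2) * (x\<^sup>2 + s\<^sup>2) \<le> 0" by simp
      moreover have "x\<^sup>2 + s\<^sup>2 > 0" using s by (simp add: add_nonneg_pos)
      ultimately have "x\<^sup>2 \<le> r\<^sup>2" by (simp add: mult_le_0_iff)
      then show "\<bar>x\<bar> \<le> r" using r by (simp add: abs_le_square_iff[symmetric])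
    }
    assume x: "\<bar>x\<bar> \<le> r"
    then have "x\<^sup>2 \<le> r\<^sup>2" using r by (simp add: abs_le_square_iff[symmetric])
    then have "y\<^sup>2 \<le> s\<^sup>2" using hyp by simp
    then have "\<bar>y\<bar> \<le> s" using s by (simp add: abs_le_square_iff[symmetric])
    with x show "\<bar>x * y\<bar> \<le> r * s" by (simp add: abs_mult mult_mono)
  qed
  have sqrt_iff: "y = - sqrt t \<or> y = sqrt t \<longleftrightarrow> y\<^sup>2 = t" if "0 \<le> t" for y t :: real
    using that by (metis real_sqrt_abs real_sqrt_pow2 abs_eq_iff' power2_minus real_sqrt_ge_zero
        abs_of_nonneg abs_minus_cancel)
  show ?thesis
  proof (cases "\<beta> - \<alpha> \<le> \<delta> - \<gamma>")
    case True
    then have rs: "r \<le> s" by (simp add: r_def s_def)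
    \<comment> \<open>The radicand of \<open>h_minus\<close> and \<open>h_plus\<close> in centred
      coordinates. The case assumption makes it nonnegative, so the two branches together say
      \<open>y^2 = t\<close>.\<close>
    define t where "t = s\<^sup>2 + x\<^sup>2 - r\<^sup>2"
    have "((\<delta> - \<gamma>) / 2)\<^sup>2 + (Re z - \<alpha>) * (Re z - \<beta>) = t"
      by (simp add: t_def x_def r_def s_def power2_eq_square field_simps)
    then have "z \<in> Gamma_curve \<alpha> \<beta> \<gamma> \<delta> \<longleftrightarrow> \<bar>x\<bar> \<le> r \<and> (y = - sqrt t \<or> y = sqrt t)"
      using True by (auto simp: Gamma_curve_def image_iff complex_eq_iff h_minus_def h_plus_def
          x_def y_def r_def abs_le_iff field_simps)
    also have "\<dots> \<longleftrightarrow> \<bar>x\<bar> \<le> r \<and> y\<^sup>2 = t"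
    proof -
      have "r\<^sup>2 \<le> s\<^sup>2" using rs r by (simp add: power_mono)
      then have "0 \<le> t" by (simp add: t_def add_increasing2)
      then show ?thesis by (simp add: sqrt_iff)
    qed
    finally show ?thesis using box unfolding x_def y_def t_def by auto
  next
    case False
    then have rs: "s \<le> r" by (simp add: r_def s_def)
    define t where "t = r\<^sup>2 + y\<^sup>2 - s\<^sup>2"
    have "((\<beta> - \<alpha>) / 2)\<^sup>2 + (Im z - \<gamma>) * (Im z - \<delta>) = t"
      by (simp add: t_def y_def r_def s_def power2_eq_square field_simps)
    then have "z \<in> Gamma_curve \<alpha> \<beta> \<gamma> \<delta> \<longleftrightarrow> \<bar>y\<bar> \<le> s \<and> (x = - sqrt t \<or> x = sqrt t)"
      using False by (auto simp: Gamma_curve_def image_iff complex_eq_iff k_minus_def k_plus_def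
          x_def y_def s_def abs_le_iff field_simps)
    also have "\<dots> \<longleftrightarrow> \<bar>y\<bar> \<le> s \<and> x\<^sup>2 = t"
    proof -
      have "s\<^sup>2 \<le> r\<^sup>2" using rs s by (simp add: power_mono)
      then have "0 \<le> t" by (simp add: t_def add_increasing2)
      then show ?thesis by (simp add: sqrt_iff)
    qed
    also have "\<dots> \<longleftrightarrow> x\<^sup>2 - y\<^sup>2 = r\<^sup>2 - s\<^sup>2 \<and> \<bar>x\<bar> \<le> r"
      using abs_le_square_iff[of x r] abs_le_square_iff[of y s] r s by (auto simp: t_def)
    finally show ?thesis using box unfolding x_def y_def by auto
  qed
qed


section \<open>Spectra of \<open>D + i E\<close> for square roots of scalars\<close>

text \<open>Moving one \<open>D\<close> across the inner product turns the squared norm of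
  \<open>D x\<close> into the inner product of \<open>D (D x)\<close> with \<open>x\<close>.\<close>

lemma selfadjoint_square_norm:
  fixes D :: "'a::complex_inner \<Rightarrow> 'a"
  assumes D: "bounded_selfadjoint D" and sq: "\<And>x. D (D x) = complex_of_real (r\<^sup>2) *\<^sub>C x"
    and "0 \<le> r"
  shows "norm (D x) = r * norm x"
proof -
  have "cinner (D x) (D x) = cinner (D (D x)) x"
    using D by (simp add: bounded_selfadjoint_def)
  then have "complex_of_real ((norm (D x))\<^sup>2) = complex_of_real ((r * norm x)\<^sup>2)"
    by (simp add: sq cinner_simps cinner_self power_mult_distrib)
  then have "(norm (D x))\<^sup>2 = (r * norm x)\<^sup>2" unfolding of_real_eq_iff .
  then show ?thesis using assms(3) by simp
qed

text \<open>The square of \<open>N = D + i E\<close> is \<open>r\<^sup>2 - s\<^sup>2 + i (D E + E D)\<close>, and the self-adjoint operator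
  \<open>D E + E D\<close> has numerical range in \<open>[-2 r s, 2 r s]\<close>.\<close>

lemma spectrum_sum_square_roots:
  fixes D E :: "'a::complex_hilbert_space \<Rightarrow> 'a"
  assumes D: "bounded_selfadjoint D" "\<And>x. D (D x) = complex_of_real (r\<^sup>2) *\<^sub>C x" "0 \<le> r"
    and E: "bounded_selfadjoint E" "\<And>x. E (E x) = complex_of_real (s\<^sup>2) *\<^sub>C x" "0 \<le> s"
    and w: "w \<in> spectrum (\<lambda>x. D x + \<i> *\<^sub>C E x)"
  shows "(Re w)\<^sup>2 - (Im w)\<^sup>2 = r\<^sup>2 - s\<^sup>2 \<and> \<bar>Re w * Im w\<bar> \<le> r * s"
proof -
  have bD: "bounded_clinear D" and bE: "bounded_clinear E"
    using D E by (auto simp: bounded_selfadjoint_def)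
  note lin = bounded_clinear_simps[OF bD] bounded_clinear_simps[OF bE]
  define N where "N x = D x + \<i> *\<^sub>C E x" for x
  have bN: "bounded_clinear N" unfolding N_def
    by (intro bounded_clinear_add bounded_clinear_scaleC bD bE)
  note linN = bounded_clinear_simps[OF bN]
  define Q where "Q x = N (N x) - w\<^sup>2 *\<^sub>C x" for x
  have bQ: "bounded_clinear Q"
    unfolding Q_def by (intro bounded_clinear_diff bounded_clinear_compose[OF bN bN]
        bounded_clinear_scaleC bounded_clinear_id)
  have "\<not> cinvertible Q"
  proof
    assume "cinvertible Q"
    then have "cinvertible (\<lambda>x. N x - w *\<^sub>C x)"
      unfolding Q_def by (rule cinvertible_square_factor[OF bN])
    with w show False by (simp add: spectrum_iff N_def)
  qed
  \<comment> \<open>Used below with \<open>c\<close> equal to \<open>p\<close>, \<open>\<i>\<close>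
    and \<open>- \<i>\<close>, each excluding one way in which the numerical range of
    \<open>Q\<close> could stay away from 0.\<close>
  then have noncoercive: "\<not> (\<forall>x. m * (norm x)\<^sup>2 \<le> Re (c * cinner (Q x) x))"
    if "c \<noteq> 0" "m > 0" for c m
    using rotated_coercive_cinvertible[OF bQ that] by blast
  define h where "h x = Re (cinner (E x) (D x))" for x
  have Q_form: "cinner (Q x) x =
      (complex_of_real (r\<^sup>2 - s\<^sup>2) - w\<^sup>2) * complex_of_real ((norm x)\<^sup>2) + \<i> * complex_of_real (2 * h x)"
    for x
  proof -
    have "Q x = (complex_of_real (r\<^sup>2 - s\<^sup>2) - w\<^sup>2) *\<^sub>C x + \<i> *\<^sub>C (D (E x) + E (D x))"
      by (simp add: Q_def N_def lin cvec_simps D(2) E(2) algebra_simps)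
    moreover have "cinner (D (E x) + E (D x)) x = complex_of_real (2 * h x)"
    proof -
      have "cinner (D (E x) + E (D x)) x = cinner (E x) (D x) + cinner (D x) (E x)"
        using D(1) E(1) by (simp add: bounded_selfadjoint_def cinner_simps)
      also have "\<dots> = cinner (E x) (D x) + cnj (cinner (E x) (D x))"
        by (metis cinner_commute)
      finally show ?thesis by (simp add: h_def complex_add_cnj)
    qed
    ultimately show ?thesis by (simp add: cinner_simps cinner_self)
  qed
  have h_bound: "\<bar>h x\<bar> \<le> r * s * (norm x)\<^sup>2" for x
  proof -
    have "\<bar>h x\<bar> \<le> norm (E x) * norm (D x)"
      unfolding h_def by (rule order_trans[OF abs_Re_le_cmod norm_cinner_le])
    then show ?thesis
      by (simp add: selfadjoint_square_norm[OF D] selfadjoint_square_norm[OF E]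
          power2_eq_square mult_ac)
  qed
  \<comment> \<open>On unit vectors the form of \<open>Q\<close> has constant real part
    \<open>p\<close> and imaginary part \<open>2 h x - q\<close>.\<close>
  define p q where "p = r\<^sup>2 - s\<^sup>2 - Re (w\<^sup>2)" and "q = Im (w\<^sup>2)"
  have Re_form: "Re (\<i> * cinner (Q x) x) = q * (norm x)\<^sup>2 - 2 * h x" for x
    by (simp add: Q_form q_def algebra_simps)
  have "p = 0"
  proof (rule ccontr)
    assume "p \<noteq> 0"
    moreover have "\<forall>x. p\<^sup>2 * (norm x)\<^sup>2 \<le> Re (complex_of_real p * cinner (Q x) x)"
      by (simp add: Q_form p_def power2_eq_square algebra_simps)
    ultimately show False using noncoercive[of "complex_of_real p" "p\<^sup>2"] by simp
  qed
  moreover have "q \<le> 2 * r * s"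
  proof (rule ccontr)
    assume "\<not> q \<le> 2 * r * s"
    moreover have "(q - 2 * r * s) * (norm x)\<^sup>2 \<le> Re (\<i> * cinner (Q x) x)" for x
      unfolding mult_minus_left uminus_complex.sel Re_form
      using abs_le_D1[OF h_bound[of x]] by (simp add: left_diff_distrib)
    ultimately show False using noncoercive[of "\<i>" "q - 2 * r * s"] by simp
  qed
  moreover have "- q \<le> 2 * r * s"
  proof (rule ccontr)
    assume "\<not> - q \<le> 2 * r * s"
    moreover have "(- q - 2 * r * s) * (norm x)\<^sup>2 \<le> Re (- \<i> * cinner (Q x) x)" for x
      unfolding mult_minus_left uminus_complex.sel Re_form
      using abs_le_D2[OF h_bound[of x]] by (simp add: left_diff_distrib)
    ultimately show False using noncoercive[of "- \<i>" "- q - 2 * r * s"] by simp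
  qed
  ultimately show ?thesis
    by (simp add: p_def q_def power2_eq_square abs_le_iff algebra_simps)
qed

text \<open>The operator \<open>E\<close> is \<open>s\<close> times the reflection fixing the unit vector \<open>e = p u + q v\<close>. The plane
  spanned by the eigenvectors \<open>u\<close>, \<open>v\<close> of \<open>D\<close> is invariant under \<open>D\<close> and \<open>E\<close>, and on it
  \<open>D + i E\<close> is traceless with square \<open>r\<^sup>2 - s\<^sup>2 + 2 i r s (p\<^sup>2 - q\<^sup>2)\<close>.\<close>

lemma exists_square_root_with_sum_eigenvalue:
  fixes D :: "'a::complex_inner \<Rightarrow> 'a"
  assumes D: "bounded_selfadjoint D"
    and u: "norm u = 1" "D u = complex_of_real r *\<^sub>C u"
    and v: "norm v = 1" "D v = (- complex_of_real r) *\<^sub>C v"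
    and rs: "0 < r" "0 < s"
    and w: "(Re w)\<^sup>2 - (Im w)\<^sup>2 = r\<^sup>2 - s\<^sup>2" "\<bar>Re w * Im w\<bar> \<le> r * s"
  shows "\<exists>E. bounded_selfadjoint E \<and> spectrum E = {complex_of_real s, - complex_of_real s} \<and>
    w \<in> spectrum (\<lambda>x. D x + \<i> *\<^sub>C E x)"
proof -
  have bD: "bounded_clinear D" using D by (rule bounded_selfadjoint_bounded_clinear)
  have uu: "cinner u u = 1" and vv: "cinner v v = 1" using u v by (simp_all add: cinner_self)
  have uv: "cinner u v = 0"
  proof -
    have "cinner (D u) v = cinner u (D v)" using D by (simp add: bounded_selfadjoint_def)
    then have "2 * complex_of_real r * cinner u v = 0" by (simp add: u v cinner_simps)
    then show ?thesis using rs by simp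
  qed
  have vu: "cinner v u = 0" using uv cinner_commute[of v u] by simp
  \<comment> \<open>Chosen so that \<open>2 r s c\<close> is the imaginary part of
    \<open>w^2\<close>; the bound on \<open>w\<close> makes \<open>c\<close> a cosine.\<close>
  define c where "c = Re w * Im w / (r * s)"
  have c: "\<bar>c\<bar> \<le> 1" "r * s * c = Re w * Im w" using rs w by (auto simp: c_def abs_mult)
  \<comment> \<open>Half-angle formulas: \<open>p^2 + q^2 = 1\<close> makes \<open>e\<close> a unit
    vector, and \<open>p^2 - q^2 = c\<close>. The matching sine is \<open>k\<close>.\<close>
  define p q where "p = sqrt ((1 + c) / 2)" and "q = sqrt ((1 - c) / 2)"
  have p2: "p * p = (1 + c) / 2" and q2: "q * q = (1 - c) / 2"
    using c by (auto simp: p_def q_def)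
  define k where "k = 2 * p * q"
  have k2: "k * k = 1 - c * c"
  proof -
    have "k * k = 4 * (p * p) * (q * q)" by (simp add: k_def)
    then show ?thesis by (simp add: p2 q2 field_simps)
  qed
  \<comment> \<open>The vector \<open>f\<close> is orthogonal to \<open>e\<close>, so the reflection
    negates it; it witnesses the spectral value \<open>-s\<close> of \<open>E\<close>.\<close>
  define e f where "e = complex_of_real p *\<^sub>C u + complex_of_real q *\<^sub>C v"
    and "f = complex_of_real p *\<^sub>C v - complex_of_real q *\<^sub>C u"
  have ee: "cinner e e = 1" and ff: "cinner f f = 1"
    using p2 q2 by (simp_all add: e_def f_def cinner_simps uu vv uv vu complex_eq_iff)
  have fe: "cinner f e = 0"
    by (simp add: e_def f_def cinner_simps uu vv uv vu)
  have nz: "e \<noteq> 0" "f \<noteq> 0" using ee ff by auto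
  have ne: "norm e = 1"
  proof -
    have "(norm e)\<^sup>2 = 1" using ee unfolding cinner_self by (metis of_real_eq_1_iff)
    then show ?thesis by (simp add: power2_eq_1_iff) (smt (verit) norm_ge_zero)
  qed
  define E where "E x = complex_of_real s *\<^sub>C ((2 * cinner x e) *\<^sub>C e - x)" for x
  have bE: "bounded_clinear E"
    unfolding E_def
  proof (intro bounded_clinear_scaleC bounded_clinear_diff bounded_clinear_id bounded_clinearI)
    show "norm ((2 * cinner x e) *\<^sub>C e) \<le> norm x * 2" for x
      using norm_cinner_le[of x e] by (simp add: ne norm_mult)
  qed (simp_all add: cinner_simps cvec_simps algebra_simps)
  have E: "bounded_selfadjoint E"
  proof -
    have "cinner (E x) y = cinner x (E y)" for x y
      using cinner_commute[of e y] by (simp add: E_def cinner_simps)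
    then show ?thesis using bE by (simp add: bounded_selfadjoint_def)
  qed
  have EE: "E (E x) = (complex_of_real s)\<^sup>2 *\<^sub>C x" for x
    by (simp add: E_def cinner_simps cvec_simps ee power2_eq_square algebra_simps)
  have "2 *\<^sub>C e - e = e"
    using cvec.scale_left_diff_distrib[of 2 1 e] by (simp add: scaleC_one)
  then have Ee: "E e = complex_of_real s *\<^sub>C e"
    by (simp add: E_def ee)
  have Ef: "E f = (- complex_of_real s) *\<^sub>C f"
    by (simp add: E_def fe)
  have spE: "spectrum E = {complex_of_real s, - complex_of_real s}"
    using spectrum_square_subset[OF bE EE] eigenvalue_in_spectrum[of E, OF Ee nz(1)]
      eigenvalue_in_spectrum[of E, OF Ef nz(2)] by blast
  have Eu: "E u = complex_of_real (s * c) *\<^sub>C u + complex_of_real (s * k) *\<^sub>C v"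
  proof -
    have "E u = complex_of_real (s * (2 * (p * p) - 1)) *\<^sub>C u + complex_of_real (s * k) *\<^sub>C v"
      by (simp add: E_def e_def cinner_simps cvec_simps uu uv k_def algebra_simps)
    moreover have "2 * (p * p) - 1 = c" using p2 by (simp add: field_simps)
    ultimately show ?thesis by (simp only:)
  qed
  have Ev: "E v = complex_of_real (s * k) *\<^sub>C u - complex_of_real (s * c) *\<^sub>C v"
  proof -
    have "E v = complex_of_real (s * k) *\<^sub>C u - complex_of_real (s * (1 - 2 * (q * q))) *\<^sub>C v"
      by (simp add: E_def e_def cinner_simps cvec_simps vv vu k_def algebra_simps)
    moreover have "1 - 2 * (q * q) = c" using q2 by (simp add: field_simps)
    ultimately show ?thesis by (simp only:)
  qed
  define N where "N x = D x + \<i> *\<^sub>C E x" for x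
  have bN: "bounded_clinear N" unfolding N_def
    by (intro bounded_clinear_add bounded_clinear_scaleC bD bE)
  note linN = bounded_clinear_simps[OF bN]
  define \<alpha> \<beta> where "\<alpha> = complex_of_real r + \<i> * complex_of_real (s * c)"
    and "\<beta> = \<i> * complex_of_real (s * k)"
  have Nu: "N u = \<alpha> *\<^sub>C u + \<beta> *\<^sub>C v"
    by (simp add: N_def u Eu \<alpha>_def \<beta>_def cvec_simps algebra_simps)
  have Nv: "N v = \<beta> *\<^sub>C u - \<alpha> *\<^sub>C v"
    by (simp add: N_def v Ev \<alpha>_def \<beta>_def cvec_simps algebra_simps)
  have w2: "w * w = \<alpha> * \<alpha> + \<beta> * \<beta>"
  proof (rule complex_eqI)
    have "s * c * (s * c) + s * k * (s * k) = s * s * (c * c + k * k)" by (simp add: algebra_simps)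
    then show "Re (w * w) = Re (\<alpha> * \<alpha> + \<beta> * \<beta>)"
      using w(1) by (simp add: \<alpha>_def \<beta>_def k2 power2_eq_square)
    show "Im (w * w) = Im (\<alpha> * \<alpha> + \<beta> * \<beta>)"
      using c(2) by (simp add: \<alpha>_def \<beta>_def algebra_simps)
  qed
  have NNu: "N (N u) = (w * w) *\<^sub>C u" and NNv: "N (N v) = (w * w) *\<^sub>C v"
    by (simp_all add: Nu Nv linN w2 cvec_simps algebra_simps)
  have "w \<in> spectrum N"
  proof (rule ccontr)
    assume w': "w \<notin> spectrum N"
    \<comment> \<open>As \<open>(N - w)(N + w) x = 0\<close>, the vector \<open>(N + w) x\<close>
      would be an eigenvector for \<open>w\<close> unless it vanishes. For \<open>u\<close> and
      \<open>v\<close> the diagonal coefficients then give \<open>w = -\<alpha>\<close> and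
      \<open>w = \<alpha>\<close>, whereas \<open>\<alpha>\<close> has real part
      \<open>r > 0\<close>.\<close>
    have kill: "N x + w *\<^sub>C x = 0" if "N (N x) = (w * w) *\<^sub>C x" for x
      using eigenvalue_in_spectrum[of N "N x + w *\<^sub>C x" w] w' that
      by (auto simp: linN cvec_simps add.commute)
    have "cinner (N u + w *\<^sub>C u) u = 0" "cinner (N v + w *\<^sub>C v) v = 0"
      by (simp_all add: kill NNu NNv)
    then have "\<alpha> + w = 0" "- \<alpha> + w = 0"
      by (simp_all add: Nu Nv cinner_simps uu vv uv vu)
    then have "\<alpha> = 0" by (simp add: add_eq_0_iff)
    then show False using rs by (simp add: \<alpha>_def complex_eq_iff)
  qed
  then show ?thesis using E spE unfolding N_def by blast
qed

section \<open>Reduction to the centred operators\<close>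

theorem corollary3p8:
  fixes a_minus a_plus b_minus b_plus :: real
    and A :: "'a::complex_hilbert_space \<Rightarrow> 'a"
  assumes "a_minus < a_plus" and "b_minus < b_plus"
    and "bounded_selfadjoint A"
    and "spectrum A = {complex_of_real a_minus, complex_of_real a_plus}"
  shows "(\<forall>B :: 'a \<Rightarrow> 'a. bounded_selfadjoint B \<longrightarrow>
            spectrum B = {complex_of_real b_minus, complex_of_real b_plus} \<longrightarrow>
            spectrum (\<lambda>x. A x + \<i> *\<^sub>C B x) \<subseteq> Gamma_curve a_minus a_plus b_minus b_plus) \<and>
         (\<forall>z \<in> Gamma_curve a_minus a_plus b_minus b_plus.
            \<exists>B :: 'a \<Rightarrow> 'a. bounded_selfadjoint B \<and>
              spectrum B = {complex_of_real b_minus, complex_of_real b_plus} \<and>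
              z \<in> spectrum (\<lambda>x. A x + \<i> *\<^sub>C B x))"
proof -
  define a b where "a = (a_minus + a_plus) / 2" and "b = (b_minus + b_plus) / 2"
  define r s where "r = (a_plus - a_minus) / 2" and "s = (b_plus - b_minus) / 2"
  have rs: "0 < r" "0 < s" using assms(1,2) by (auto simp: r_def s_def)
  have ends: "a_minus = a - r" "a_plus = a + r" "b_minus = b - s" "b_plus = b + s"
    by (simp_all add: a_def b_def r_def s_def field_simps)
  have Gamma: "z \<in> Gamma_curve a_minus a_plus b_minus b_plus \<longleftrightarrow>
      (Re (z - Complex a b))\<^sup>2 - (Im (z - Complex a b))\<^sup>2 = r\<^sup>2 - s\<^sup>2 \<and>
      \<bar>Re (z - Complex a b) * Im (z - Complex a b)\<bar> \<le> r * s" for z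
    using Gamma_curve_iff[OF assms(1,2)] by (simp add: a_def b_def r_def s_def)
  define D where "D x = A x - complex_of_real a *\<^sub>C x" for x
  have D: "bounded_selfadjoint D"
    unfolding D_def using assms(3) by (rule bounded_selfadjoint_shift)
  have spD: "spectrum D = {complex_of_real r, - complex_of_real r}"
    unfolding D_def set_eq_iff spectrum_shift assms(4) ends by (auto simp: complex_eq_iff)
  have DD: "D (D x) = complex_of_real (r\<^sup>2) *\<^sub>C x" for x
    using D spD by (intro selfadjoint_square_eq) auto
  \<comment> \<open>The two real shifts combine into a translation by the centre
    \<open>a + i b\<close> of the curve.\<close>
  have sum_shift: "z \<in> spectrum (\<lambda>x. A x + \<i> *\<^sub>C B x) \<longleftrightarrow>
      z - Complex a b \<in> spectrum (\<lambda>x. D x + \<i> *\<^sub>C (B x - complex_of_real b *\<^sub>C x))"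
    for z and B :: "'a \<Rightarrow> 'a"
  proof -
    have "D x + \<i> *\<^sub>C (B x - complex_of_real b *\<^sub>C x) = A x + \<i> *\<^sub>C B x - Complex a b *\<^sub>C x" for x
      by (simp add: D_def Complex_eq cvec_simps algebra_simps)
    then show ?thesis by (simp add: spectrum_shift)
  qed
  show ?thesis
  proof (intro conjI allI impI ballI subsetI)
    fix B :: "'a \<Rightarrow> 'a" and z
    assume B: "bounded_selfadjoint B"
      and spB: "spectrum B = {complex_of_real b_minus, complex_of_real b_plus}"
      and z: "z \<in> spectrum (\<lambda>x. A x + \<i> *\<^sub>C B x)"
    define E where "E x = B x - complex_of_real b *\<^sub>C x" for x
    have E: "bounded_selfadjoint E" unfolding E_def using B by (rule bounded_selfadjoint_shift)
    have spE: "spectrum E = {complex_of_real s, - complex_of_real s}"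
      unfolding E_def set_eq_iff spectrum_shift spB ends by (auto simp: complex_eq_iff)
    have "E (E x) = complex_of_real (s\<^sup>2) *\<^sub>C x" for x
      using E spE by (intro selfadjoint_square_eq) auto
    then show "z \<in> Gamma_curve a_minus a_plus b_minus b_plus"
      unfolding Gamma using z rs
      by (intro spectrum_sum_square_roots[OF D DD _ E]) (auto simp: sum_shift E_def)
  next
    fix z assume z: "z \<in> Gamma_curve a_minus a_plus b_minus b_plus"
    have bD: "bounded_clinear D" using D by (rule bounded_selfadjoint_bounded_clinear)
    obtain u where u: "norm u = 1" "D u = complex_of_real r *\<^sub>C u"
      using square_eigenvector[of D "complex_of_real r"] bD DD spD rs by auto
    \<comment> \<open>The same lemma applies to \<open>-r\<close>, which has the same square as
      \<open>r\<close>.\<close>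
    obtain v where v: "norm v = 1" "D v = (- complex_of_real r) *\<^sub>C v"
      using square_eigenvector[of D "- complex_of_real r"] bD DD spD rs by auto
    obtain E where E: "bounded_selfadjoint E"
      "spectrum E = {complex_of_real s, - complex_of_real s}"
      "z - Complex a b \<in> spectrum (\<lambda>x. D x + \<i> *\<^sub>C E x)"
      using exists_square_root_with_sum_eigenvalue[OF D u v rs] z unfolding Gamma by blast
    \<comment> \<open>The addition of \<open>b\<close> is written as subtraction of
      \<open>- b\<close> to fit the shift lemmas.\<close>
    define B where "B x = E x - complex_of_real (- b) *\<^sub>C x" for x
    have "bounded_selfadjoint B" unfolding B_def using E(1) by (rule bounded_selfadjoint_shift)
    moreover have "spectrum B = {complex_of_real b_minus, complex_of_real b_plus}"
      unfolding B_def set_eq_iff spectrum_shift E(2) ends by (auto simp: complex_eq_iff)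
    moreover have "z \<in> spectrum (\<lambda>x. A x + \<i> *\<^sub>C B x)"
      unfolding sum_shift using E(3) by (simp add: B_def)
    ultimately show "\<exists>B. bounded_selfadjoint B \<and>
        spectrum B = {complex_of_real b_minus, complex_of_real b_plus} \<and>
        z \<in> spectrum (\<lambda>x. A x + \<i> *\<^sub>C B x)" by blast
  qed
qed

end
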